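(* Let $G$ be a graph that is a proper interval $k$-graph or a unit interval $k$-graph, and fix a representation of $G$ witnessing this; regard the interval classes of this representation as the partite sets of $G$. Then $V(G)$ can be labeled $v_1,v_2,\dots,v_n$ so that, whenever $i<j<k'$ and $v_iv_{k'}\in E(G)$, the vertex $v_j$ is adjacent to each vertex of $\{v_i,v_{k'}\}$ that lies in a different partite set than $v_j$.
   Context: All graphs are finite and simple. A graph $G$ is an interval $k$-graph if there is a one-to-one correspondence $v\mapsto I_v$ between $V(G)$ and a family of closed intervals of the real line, together with a partition of the family into at most $k$ classes, such that distinct vertices $u,v$ are adjacent if and only if $I_u\cap I_v\neq\emptyset$ and $I_u,I_v$ lie in different classes; such a family with its partition is a representation. $G$ is a proper interval $k$-graph if it has such a representation in which no interval properly contains another interval (of any class), and a unit interval $k$-graph if it has such a representation in which all intervals have the same length. *)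

theory Defs
  imports Complex_Main "HOL-Library.Disjoint_Sets" "Graph_Theory.Pair_Digraph"
begin

text \<open>
  A finite simple graph is a \<^locale>\<open>pair_graph\<close> (finite, loopfree, symmetric, without parallel
  arcs): the vertices are \<^term>\<open>pverts G\<close>, and the edge uv is present iff
  \<^term>\<open>(u, v) \<in> parcs G\<close>, equivalently \<^term>\<open>(v, u) \<in> parcs G\<close>.
\<close>

definition closed_interval :: "real set \<Rightarrow> bool" where
  "closed_interval S \<longleftrightarrow> (\<exists>a b. a \<le> b \<and> S = {a..b})"

definition interval_length :: "real set \<Rightarrow> real" where
  "interval_length S = Sup S - Inf S"

definition in_different_classes :: "'a set set \<Rightarrow> 'a \<Rightarrow> 'a \<Rightarrow> bool" where
  "in_different_classes P x y \<longleftrightarrow> (\<exists>A\<in>P. \<exists>B\<in>P. x \<in> A \<and> y \<in> B \<and> A \<noteq> B)"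

text \<open>
  The family of intervals is an indexed family \<^term>\<open>I\<close> over the index set \<^term>\<open>J\<close>, so the same
  interval may occur several times, in one class or in several. \<^term>\<open>P\<close> partitions the
  members of the family, given by their indices, and \<^term>\<open>\<phi>\<close> is the one-to-one
  correspondence between vertices and members: the interval of the vertex v is
  \<^term>\<open>I (\<phi> v)\<close>. A family given as a set of intervals is the case \<^term>\<open>I = (\<lambda>S. S)\<close>.
\<close>

definition interval_k_rep ::
  "nat \<Rightarrow> 'v pair_pre_digraph \<Rightarrow> 'i set \<Rightarrow> ('i \<Rightarrow> real set) \<Rightarrow> 'i set set \<Rightarrow> ('v \<Rightarrow> 'i) \<Rightarrow> bool"
where
  "interval_k_rep k G J I P \<phi> \<longleftrightarrow>
     (\<forall>j\<in>J. closed_interval (I j)) \<and>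
     partition_on J P \<and> card P \<le> k \<and>
     bij_betw \<phi> (pverts G) J \<and>
     (\<forall>u\<in>pverts G. \<forall>v\<in>pverts G. u \<noteq> v \<longrightarrow>
        ((u, v) \<in> parcs G \<longleftrightarrow>
           I (\<phi> u) \<inter> I (\<phi> v) \<noteq> {} \<and> in_different_classes P (\<phi> u) (\<phi> v)))"

definition proper_interval_k_rep ::
  "nat \<Rightarrow> 'v pair_pre_digraph \<Rightarrow> 'i set \<Rightarrow> ('i \<Rightarrow> real set) \<Rightarrow> 'i set set \<Rightarrow> ('v \<Rightarrow> 'i) \<Rightarrow> bool"
where
  "proper_interval_k_rep k G J I P \<phi> \<longleftrightarrow>
     interval_k_rep k G J I P \<phi> \<and> (\<forall>i\<in>J. \<forall>j\<in>J. \<not> I i \<subset> I j)"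

definition unit_interval_k_rep ::
  "nat \<Rightarrow> 'v pair_pre_digraph \<Rightarrow> 'i set \<Rightarrow> ('i \<Rightarrow> real set) \<Rightarrow> 'i set set \<Rightarrow> ('v \<Rightarrow> 'i) \<Rightarrow> bool"
where
  "unit_interval_k_rep k G J I P \<phi> \<longleftrightarrow>
     interval_k_rep k G J I P \<phi> \<and>
     (\<forall>i\<in>J. \<forall>j\<in>J. interval_length (I i) = interval_length (I j))"

definition partite_sets ::
  "'v pair_pre_digraph \<Rightarrow> 'i set set \<Rightarrow> ('v \<Rightarrow> 'i) \<Rightarrow> 'v set set"
where
  "partite_sets G P \<phi> = (\<lambda>C. {v \<in> pverts G. \<phi> v \<in> C}) ` P"

end

theory Submission
  imports Defs
begin

text \<open>
  Label the vertices by increasing left endpoint. Without proper containment the right endpoints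
  are then increasing too, so when the intervals of \<open>v\<^sub>i\<close> and \<open>v\<^sub>l\<close> meet, the left endpoint of
  the latter lies in every interval in between.
\<close>

lemma closed_interval_Inf_le_Sup:
  assumes "closed_interval S"
  shows "Inf S \<le> Sup S"
  using assms by (auto simp: closed_interval_def)

lemma closed_interval_eq_Inf_Sup:
  assumes "closed_interval S"
  shows "S = {Inf S..Sup S}"
  using assms by (auto simp: closed_interval_def)

text \<open>If \<open>S\<close> lies in \<open>T\<close>, its left endpoint is no smaller and its
  right endpoint no larger than those of \<open>T\<close>. Equal lengths then force both endpoints
  to coincide, so the inclusion cannot be strict.\<close>

lemma not_psubset_if_interval_length_eq:
  assumes "closed_interval S" "closed_interval T" "interval_length S = interval_length T"
  shows "\<not> S \<subset> T"
  using assms by (auto simp: closed_interval_def interval_length_def)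

text \<open>Were \<open>Sup T < Sup S\<close>, then \<open>T\<close> would lie in \<open>S\<close>
  and miss its right endpoint, hence be a proper subset.\<close>

lemma Sup_le_if_Inf_le:
  assumes S: "closed_interval S" and T: "closed_interval T" and "\<not> T \<subset> S" "Inf S \<le> Inf T"
  shows "Sup S \<le> Sup T"
  using assms by (auto simp: closed_interval_def psubset_eq)

text \<open>A single point common to all three sets is exhibited, so that it shows at once that
  \<open>S\<close> meets \<open>R\<close> and that \<open>S\<close> meets \<open>T\<close>.\<close>

lemma Inf_in_between:
  assumes "closed_interval R" "closed_interval S" "closed_interval T"
    and "\<not> S \<subset> R" "Inf R \<le> Inf S" "Inf S \<le> Inf T" "R \<inter> T \<noteq> {}"
  shows "Inf T \<in> R \<inter> S \<inter> T"
proof -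
  have "Sup R \<le> Sup S"
    using assms by (intro Sup_le_if_Inf_le)
  \<comment> \<open>Any common point of \<open>R\<close> and \<open>T\<close> is at least
    \<open>Inf T\<close> and at most \<open>Sup R\<close>.\<close>
  moreover have "Inf T \<le> Sup R"
    using assms by (auto simp: closed_interval_def)
  ultimately have "Inf T \<in> {Inf R..Sup R} \<inter> {Inf S..Sup S} \<inter> {Inf T..Sup T}"
    using assms closed_interval_Inf_le_Sup[of T] by simp
  then show ?thesis
    using assms by (simp flip: closed_interval_eq_Inf_Sup)
qed

lemma unit_interval_k_rep_imp_proper:
  assumes "unit_interval_k_rep k G J I P \<phi>"
  shows "proper_interval_k_rep k G J I P \<phi>"
  using assms
  unfolding unit_interval_k_rep_def proper_interval_k_rep_def interval_k_rep_def
  by (meson not_psubset_if_interval_length_eq)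

lemma in_different_classes_commute:
  "in_different_classes P x y \<longleftrightarrow> in_different_classes P y x"
  by (auto simp: in_different_classes_def)

text \<open>A partite set is the preimage of a class under \<open>\<phi>\<close>, so distinct
  partite sets come from distinct classes.\<close>

lemma in_different_classes_partite_setsD:
  assumes "in_different_classes (partite_sets G P \<phi>) x y"
  shows "in_different_classes P (\<phi> x) (\<phi> y)"
  using assms by (auto simp: in_different_classes_def partite_sets_def)

text \<open>Ties under \<open>f\<close> are broken arbitrarily. This matters because distinct
  vertices may share a left endpoint.\<close>

lemma finite_sorted_enumeration:
  fixes f :: "'a \<Rightarrow> 'b::linorder"
  assumes "finite A"
  obtains v :: "nat \<Rightarrow> 'a" where "bij_betw v {1..card A} A"
    and "\<And>i j. 1 \<le> i \<Longrightarrow> i \<le> j \<Longrightarrow> j \<le> card A \<Longrightarrow> f (v i) \<le> f (v j)"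
proof -
  obtain xs where "set xs = A" "distinct xs"
    using assms finite_distinct_list by blast
  \<comment> \<open>The witness is \<open>sort_key f xs\<close>.\<close>
  then obtain ys where ys: "set ys = A" "distinct ys" "sorted (map f ys)"
    using that by (metis distinct_sort set_sort sorted_sort_key)
  then have len: "length ys = card A"
    using distinct_card by fastforce
  \<comment> \<open>List positions start at 0, labels at 1.\<close>
  define v where "v i = ys ! (i - 1)" for i
  have "bij_betw (\<lambda>i. i - 1) {1..card A} {..<card A}"
    by (rule bij_betw_byWitness[where f' = Suc]) auto
  moreover have "bij_betw ((!) ys) {..<card A} A"
    using ys len by (intro bij_betw_nth) auto
  ultimately have "bij_betw v {1..card A} A"
    unfolding v_def using bij_betw_trans by (fastforce simp: comp_def)
  moreover have "f (v i) \<le> f (v j)" if "1 \<le> i" "i \<le> j" "j \<le> card A" for i j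
    using sorted_nth_mono[OF ys(3), of "i - 1" "j - 1"] that len by (simp add: v_def)
  ultimately show ?thesis
    using that by blast
qed

theorem theorem3p1:
  fixes G :: "'v pair_pre_digraph" and k :: nat
    and J :: "'i set" and I :: "'i \<Rightarrow> real set" and P :: "'i set set" and \<phi> :: "'v \<Rightarrow> 'i"
  assumes "pair_graph G"
    and "proper_interval_k_rep k G J I P \<phi> \<or> unit_interval_k_rep k G J I P \<phi>"
  shows "\<exists>v :: nat \<Rightarrow> 'v. bij_betw v {1..card (pverts G)} (pverts G) \<and>
           (\<forall>i j l. 1 \<le> i \<and> i < j \<and> j < l \<and> l \<le> card (pverts G) \<and> (v i, v l) \<in> parcs G \<longrightarrow>
              (\<forall>x \<in> {v i, v l}. in_different_classes (partite_sets G P \<phi>) x (v j) \<longrightarrow>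
                 (v j, x) \<in> parcs G))"
proof -
  interpret pair_graph G by fact
  have rep: "proper_interval_k_rep k G J I P \<phi>"
    using assms(2) unit_interval_k_rep_imp_proper by blast
  have bij_\<phi>: "bij_betw \<phi> (pverts G) J"
    using rep by (simp add: proper_interval_k_rep_def interval_k_rep_def)
  have closed: "closed_interval (I (\<phi> x))" if "x \<in> pverts G" for x
    using rep bij_betwE[OF bij_\<phi>] that
    by (simp add: proper_interval_k_rep_def interval_k_rep_def)
  have proper: "\<not> I (\<phi> x) \<subset> I (\<phi> y)" if "x \<in> pverts G" "y \<in> pverts G" for x y
    using rep bij_betwE[OF bij_\<phi>] that by (simp add: proper_interval_k_rep_def)
  have arc_iff: "(x, y) \<in> parcs G \<longleftrightarrow>
      I (\<phi> x) \<inter> I (\<phi> y) \<noteq> {} \<and> in_different_classes P (\<phi> x) (\<phi> y)"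
    if "x \<in> pverts G" "y \<in> pverts G" "x \<noteq> y" for x y
    using rep that by (simp add: proper_interval_k_rep_def interval_k_rep_def)
  obtain v where bij: "bij_betw v {1..card (pverts G)} (pverts G)"
    and mono: "\<And>i j. 1 \<le> i \<Longrightarrow> i \<le> j \<Longrightarrow> j \<le> card (pverts G) \<Longrightarrow>
      Inf (I (\<phi> (v i))) \<le> Inf (I (\<phi> (v j)))"
    by (rule finite_sorted_enumeration[OF pair_finite_verts, of "\<lambda>x. Inf (I (\<phi> x))"]) blast
  have "(v j, x) \<in> parcs G"
    if ijl: "1 \<le> i" "i < j" "j < l" "l \<le> card (pverts G)" and arc: "(v i, v l) \<in> parcs G"
      and x: "x \<in> {v i, v l}" and diff: "in_different_classes (partite_sets G P \<phi>) x (v j)"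
    for i j l x
  proof -
    have verts: "v i \<in> pverts G" "v j \<in> pverts G" "v l \<in> pverts G"
      using bij_betwE[OF bij] ijl by auto
    \<comment> \<open>\<open>arc_iff\<close> covers distinct vertices only; injectivity of the
      labeling supplies this.\<close>
    have neq: "v i \<noteq> v l" "v j \<noteq> v i" "v j \<noteq> v l"
      using bij_betw_imp_inj_on[OF bij] ijl by (auto simp: inj_on_eq_iff)
    \<comment> \<open>The arc enters only through the nonempty intersection of the two outer
      intervals.\<close>
    have "Inf (I (\<phi> (v l))) \<in> I (\<phi> (v i)) \<inter> I (\<phi> (v j)) \<inter> I (\<phi> (v l))"
      using verts neq ijl arc by (intro Inf_in_between closed proper mono) (auto simp: arc_iff)
    \<comment> \<open>The same point works whether \<open>x\<close> is \<open>v i\<close> or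
      \<open>v l\<close>.\<close>
    then have "I (\<phi> (v j)) \<inter> I (\<phi> x) \<noteq> {}"
      using x by auto
    moreover have "in_different_classes P (\<phi> (v j)) (\<phi> x)"
      using in_different_classes_partite_setsD[OF diff] in_different_classes_commute by metis
    ultimately show ?thesis
      using x verts neq by (auto simp: arc_iff)
  qed
  then show ?thesis
    using bij by blast
qed

end
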